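(* Let $T$ be the continuous linear operator from $W^{1,2}_{1/2}(\partial\Pi'_l)$ to $W^{0,2}_{1/2}(\partial\Pi'_l)$ given by $T(g)=\frac{\partial v}{\partial n}$, where $v\in W^{1,2}_0(\Pi'_l)$ is the unique solution of $\Delta v=0$ in $\Pi'_l$, $v=g$ on $\partial\Pi'_l$, and the normal derivative is understood in the weak sense described in the context. Then $T$ extends to a continuous linear map from $W^{0,2}_{-1/2}(\partial\Pi'_l)$ to $W^{-1,2}_{-1/2}(\partial\Pi'_l)$.
   Context: For $l\ge0$, $\Pi'_l=(l,\infty)\times(0,\infty)$ and $\partial\Pi'_l=E'_l\cup B'_l$ with $E'_l=\{l\}\times(0,\infty)$, $B'_l=(l,\infty)\times\{0\}$. $\rho(y)$ is the distance from $y$ to the origin. $W^{1,2}_0(\Pi'_l)$ is the space of $v$ with $v(1+\rho^2)^{-1/2}\in L^2(\Pi'_l)$ and $\nabla v\in L^2(\Pi'_l)$ (the subscript is the weight exponent; no boundary condition is implied). On the boundary, $W^{1,2}_{1/2}(\partial\Pi'_l)$ has norm squared $\int_{\partial\Pi'_l}\{(1+\rho^2)^{-1/2}g^2+(1+\rho^2)^{1/2}(g')^2\}d\sigma$, with $g'$ the tangential derivative; $W^{0,2}_{\pm1/2}(\partial\Pi'_l)$ has norm squared $\int_{\partial\Pi'_l}(1+\rho^2)^{\pm1/2}g^2\,d\sigma$; and $W^{-1,2}_{-1/2}(\partial\Pi'_l)$ is the dual of $W^{1,2}_{1/2}(\partial\Pi'_l)$, a function being identified with a functional by the pairing $h\mapsto\int_{\partial\Pi'_l}(\cdot)\,h\,d\sigma$.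 For $g\in W^{1,2}_{1/2}(\partial\Pi'_l)$, the normal derivative $\frac{\partial v}{\partial n}\in W^{0,2}_{1/2}(\partial\Pi'_l)$ is the weak limit, as $s\to0$, of the normal derivatives of the solutions of the same Dirichlet problem in the smooth domains $\{y_1>l,\ y_2>s/(y_1-l)\}$ (with data transported along lines parallel to $(1,1)$); it is characterised by the Green formula $\int_{\Pi'_l}\nabla v\cdot\nabla u\,dy=\int_{\partial\Pi'_l}\frac{\partial v}{\partial n}u\,d\sigma$ for all $u\in W^{1,2}_0(\Pi'_l)$. *)

theory Defs
  imports "HOL-Analysis.Analysis"
begin

primrec C_diff :: "nat \<Rightarrow> ('a::euclidean_space \<Rightarrow> real) \<Rightarrow> bool" where
  "C_diff 0 f \<longleftrightarrow> continuous_on UNIV f"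
| "C_diff (Suc k) f \<longleftrightarrow> (\<forall>x. f differentiable (at x)) \<and>
     (\<forall>i\<in>Basis. C_diff k (\<lambda>x. frechet_derivative f (at x) i))"

definition test_functions :: "'a::euclidean_space set \<Rightarrow> ('a \<Rightarrow> real) set" where
  "test_functions U = {\<phi>. (\<forall>k. C_diff k \<phi>) \<and>
     compact (closure {x. \<phi> x \<noteq> 0}) \<and> closure {x. \<phi> x \<noteq> 0} \<subseteq> U}"

definition locally_integrable ::
    "'a::euclidean_space set \<Rightarrow> ('a \<Rightarrow> 'b::euclidean_space) \<Rightarrow> bool" where
  "locally_integrable U f \<longleftrightarrow> (\<forall>K. compact K \<and> K \<subseteq> U \<longrightarrow> set_integrable lborel K f)"

definition is_weak_gradient ::
    "'a::euclidean_space set \<Rightarrow> ('a \<Rightarrow> real) \<Rightarrow> ('a \<Rightarrow> 'a) \<Rightarrow> bool" where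
  "is_weak_gradient U v G \<longleftrightarrow> locally_integrable U v \<and> locally_integrable U G \<and>
     (\<forall>\<phi>\<in>test_functions U. \<forall>i\<in>Basis.
        (LINT x:U|lborel. v x * frechet_derivative \<phi> (at x) i)
          = - (LINT x:U|lborel. (G x \<bullet> i) * \<phi> x))"

definition weakly_differentiable :: "'a::euclidean_space set \<Rightarrow> ('a \<Rightarrow> real) \<Rightarrow> bool" where
  "weakly_differentiable U v \<longleftrightarrow> (\<exists>G. is_weak_gradient U v G)"

text \<open>For open \<open>U\<close> a weak gradient is determined almost everywhere on \<open>U\<close>, so it does not matter
  below which representative is chosen.\<close>

definition weak_grad :: "'a::euclidean_space set \<Rightarrow> ('a \<Rightarrow> real) \<Rightarrow> 'a \<Rightarrow> 'a" where
  "weak_grad U v = (SOME G. is_weak_gradient U v G)"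

text \<open>A space of (classes of) functions is given by a set \<open>V\<close> of representatives, closed under
  pointwise linear combinations, with a seminorm \<open>N\<close>; the elements of the space are the classes of
  \<open>V\<close> modulo \<open>N\<close>-null functions. Accordingly linearity is required only modulo null elements of
  the target. A bounded map that is linear in this sense automatically respects the classes.\<close>

definition continuous_linear_map ::
    "('a \<Rightarrow> real) set \<Rightarrow> (('a \<Rightarrow> real) \<Rightarrow> real) \<Rightarrow> ('b \<Rightarrow> real) set \<Rightarrow> (('b \<Rightarrow> real) \<Rightarrow> real) \<Rightarrow>
     (('a \<Rightarrow> real) \<Rightarrow> 'b \<Rightarrow> real) \<Rightarrow> bool" where
  "continuous_linear_map V N V' N' L \<longleftrightarrow>
     (\<forall>f\<in>V. L f \<in> V') \<and>
     (\<forall>f\<in>V. \<forall>g\<in>V. \<forall>a b.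
        N' (\<lambda>z. L (\<lambda>x. a * f x + b * g x) z - (a * L f z + b * L g z)) = 0) \<and>
     (\<exists>C. \<forall>f\<in>V. N' (L f) \<le> C * N f)"

text \<open>Functionals are total functions; only their values on \<open>V\<close> matter.\<close>

definition dual_space ::
    "('a \<Rightarrow> real) set \<Rightarrow> (('a \<Rightarrow> real) \<Rightarrow> real) \<Rightarrow> (('a \<Rightarrow> real) \<Rightarrow> real) set" where
  "dual_space V N = {F.
     (\<forall>f\<in>V. \<forall>g\<in>V. \<forall>a b. F (\<lambda>x. a * f x + b * g x) = a * F f + b * F g) \<and>
     (\<exists>C. \<forall>f\<in>V. \<bar>F f\<bar> \<le> C * N f)}"

definition dual_norm ::
    "('a \<Rightarrow> real) set \<Rightarrow> (('a \<Rightarrow> real) \<Rightarrow> real) \<Rightarrow> (('a \<Rightarrow> real) \<Rightarrow> real) \<Rightarrow> real" where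
  "dual_norm V N F = Sup {\<bar>F f\<bar> | f. f \<in> V \<and> N f \<le> 1}"

definition weighted_L2 :: "'a measure \<Rightarrow> ('a \<Rightarrow> real) \<Rightarrow> ('a \<Rightarrow> real) set" where
  "weighted_L2 M w = {f \<in> borel_measurable M. integrable M (\<lambda>x. w x * (f x)\<^sup>2)}"

definition weighted_L2_norm :: "'a measure \<Rightarrow> ('a \<Rightarrow> real) \<Rightarrow> ('a \<Rightarrow> real) \<Rightarrow> real" where
  "weighted_L2_norm M w f = sqrt (LINT x|M. w x * (f x)\<^sup>2)"

definition quadrant :: "real \<Rightarrow> (real \<times> real) set" where
  "quadrant l = {l<..} \<times> {0<..}"

definition area :: "real \<Rightarrow> (real \<times> real) measure" where
  "area l = restrict_space lborel (quadrant l)"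

text \<open>Arc length parametrization of the boundary: negative parameters run through
  \<open>{l} \<times> (0,\<infinity>)\<close>, positive ones through \<open>(l,\<infinity>) \<times> {0}\<close>, and the corner, a null set,
  is at \<open>0\<close>. On the boundary, \<open>arc_coord\<close> is its inverse.\<close>

definition bdry_point :: "real \<Rightarrow> real \<Rightarrow> real \<times> real" where
  "bdry_point l t = (if t < 0 then (l, - t) else (l + t, 0))"

definition arc_coord :: "real \<Rightarrow> real \<times> real \<Rightarrow> real" where
  "arc_coord l y = fst y - l - snd y"

lemma arc_coord_bdry_point [simp]: "arc_coord l (bdry_point l t) = t"
  by (simp add: arc_coord_def bdry_point_def)

lemma range_bdry_point:
  "range (bdry_point l) = {l} \<times> {0<..} \<union> {l<..} \<times> {0} \<union> {(l, 0)}"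
proof
  show "range (bdry_point l) \<subseteq> {l} \<times> {0<..} \<union> {l<..} \<times> {0} \<union> {(l, 0)}"
    by (auto simp: bdry_point_def)
  have "y = bdry_point l (arc_coord l y)"
    if "y \<in> {l} \<times> {0<..} \<union> {l<..} \<times> {0} \<union> {(l, 0)}" for y
    using that by (auto simp: bdry_point_def arc_coord_def)
  then show "{l} \<times> {0<..} \<union> {l<..} \<times> {0} \<union> {(l, 0)} \<subseteq> range (bdry_point l)"
    by blast
qed

text \<open>The arc length measure, as a measure on the plane concentrated on the boundary. Functions
  on the boundary are represented by Borel functions on the plane, whose values off the boundary
  are irrelevant.\<close>

definition bdry_length :: "real \<Rightarrow> (real \<times> real) measure" where
  "bdry_length l = distr lborel borel (bdry_point l)"

text \<open>The weak derivative is taken along the whole boundary curve, including the corner.\<close>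

definition tangential_deriv :: "real \<Rightarrow> (real \<times> real \<Rightarrow> real) \<Rightarrow> real \<times> real \<Rightarrow> real" where
  "tangential_deriv l g y = weak_grad UNIV (g \<circ> bdry_point l) (arc_coord l y)"

definition weight :: "real \<Rightarrow> real \<times> real \<Rightarrow> real" where
  "weight \<alpha> y = (1 + (norm y)\<^sup>2) powr \<alpha>"

text \<open>The subscript \<open>\<alpha>\<close> of \<open>W\<^sup>1\<^sup>,\<^sup>2\<^sub>\<alpha>\<close> is the exponent of the weight of the
  gradient; no boundary condition is imposed, also for \<open>\<alpha> = 0\<close>.\<close>

definition W12_quadrant :: "real \<Rightarrow> real \<Rightarrow> (real \<times> real \<Rightarrow> real) set" where
  "W12_quadrant \<alpha> l = {v. v \<in> weighted_L2 (area l) (weight (\<alpha> - 1)) \<and>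
     weakly_differentiable (quadrant l) v \<and>
     (\<lambda>y. norm (weak_grad (quadrant l) v y)) \<in> weighted_L2 (area l) (weight \<alpha>)}"

definition W12_quadrant_norm :: "real \<Rightarrow> real \<Rightarrow> (real \<times> real \<Rightarrow> real) \<Rightarrow> real" where
  "W12_quadrant_norm \<alpha> l v = sqrt (
     (LINT y|area l. weight (\<alpha> - 1) y * (v y)\<^sup>2) +
     (LINT y|area l. weight \<alpha> y * (norm (weak_grad (quadrant l) v y))\<^sup>2))"

definition W02_bdry :: "real \<Rightarrow> real \<Rightarrow> (real \<times> real \<Rightarrow> real) set" where
  "W02_bdry \<alpha> l = weighted_L2 (bdry_length l) (weight \<alpha>)"

definition W02_bdry_norm :: "real \<Rightarrow> real \<Rightarrow> (real \<times> real \<Rightarrow> real) \<Rightarrow> real" where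
  "W02_bdry_norm \<alpha> l = weighted_L2_norm (bdry_length l) (weight \<alpha>)"

definition W12_bdry :: "real \<Rightarrow> real \<Rightarrow> (real \<times> real \<Rightarrow> real) set" where
  "W12_bdry \<alpha> l = {g. g \<in> weighted_L2 (bdry_length l) (weight (\<alpha> - 1)) \<and>
     weakly_differentiable UNIV (g \<circ> bdry_point l) \<and>
     tangential_deriv l g \<in> weighted_L2 (bdry_length l) (weight \<alpha>)}"

definition W12_bdry_norm :: "real \<Rightarrow> real \<Rightarrow> (real \<times> real \<Rightarrow> real) \<Rightarrow> real" where
  "W12_bdry_norm \<alpha> l g = sqrt (LINT y|bdry_length l.
     weight (\<alpha> - 1) y * (g y)\<^sup>2 + weight \<alpha> y * (tangential_deriv l g y)\<^sup>2)"

text \<open>\<open>W\<^sup>-\<^sup>1\<^sup>,\<^sup>2\<^sub>\<alpha>\<close> is the dual of \<open>W\<^sup>1\<^sup>,\<^sup>2\<^sub>-\<^sub>\<alpha>\<close>.\<close>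

definition Wm12_bdry :: "real \<Rightarrow> real \<Rightarrow> ((real \<times> real \<Rightarrow> real) \<Rightarrow> real) set" where
  "Wm12_bdry \<alpha> l = dual_space (W12_bdry (- \<alpha>) l) (W12_bdry_norm (- \<alpha>) l)"

definition Wm12_bdry_norm :: "real \<Rightarrow> real \<Rightarrow> ((real \<times> real \<Rightarrow> real) \<Rightarrow> real) \<Rightarrow> real" where
  "Wm12_bdry_norm \<alpha> l = dual_norm (W12_bdry (- \<alpha>) l) (W12_bdry_norm (- \<alpha>) l)"

definition bdry_pairing ::
    "real \<Rightarrow> (real \<times> real \<Rightarrow> real) \<Rightarrow> (real \<times> real \<Rightarrow> real) \<Rightarrow> real" where
  "bdry_pairing l f h = (LINT y|bdry_length l. f y * h y)"

text \<open>Boundary values in the sense of traces: the limit of the restrictions of smooth functions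
  approximating \<open>v\<close>. The trace map is continuous from \<open>W\<^sup>1\<^sup>,\<^sup>2\<^sub>0\<close> of the quarter-plane
  to \<open>W\<^sup>0\<^sup>,\<^sup>2\<close> of the boundary with weight exponent \<open>-1/2\<close>.\<close>

definition is_trace ::
    "real \<Rightarrow> (real \<times> real \<Rightarrow> real) \<Rightarrow> (real \<times> real \<Rightarrow> real) \<Rightarrow> bool" where
  "is_trace l v h \<longleftrightarrow> v \<in> W12_quadrant 0 l \<and> h \<in> W02_bdry (-1/2) l \<and>
     (\<exists>\<phi>. (\<forall>n. \<phi> n \<in> test_functions UNIV) \<and>
        (\<lambda>n. W12_quadrant_norm 0 l (\<lambda>y. \<phi> n y - v y)) \<longlonglongrightarrow> 0 \<and>
        (\<lambda>n. W02_bdry_norm (-1/2) l (\<lambda>y. \<phi> n y - h y)) \<longlonglongrightarrow> 0)"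

text \<open>In the integral below \<open>frechet_derivative \<phi> (at y) (\<nabla>v(y))\<close> is \<open>\<nabla>\<phi>(y) \<bullet> \<nabla>v(y)\<close>.\<close>

definition solves_dirichlet ::
    "real \<Rightarrow> (real \<times> real \<Rightarrow> real) \<Rightarrow> (real \<times> real \<Rightarrow> real) \<Rightarrow> bool" where
  "solves_dirichlet l g v \<longleftrightarrow> v \<in> W12_quadrant 0 l \<and>
     (\<forall>\<phi>\<in>test_functions (quadrant l).
        (LINT y|area l. frechet_derivative \<phi> (at y) (weak_grad (quadrant l) v y)) = 0) \<and>
     is_trace l v g"

text \<open>The Green formula determines \<open>f\<close> almost everywhere on the boundary, since the traces of
  \<open>W\<^sup>1\<^sup>,\<^sup>2\<^sub>0\<close> are dense in \<open>W\<^sup>0\<^sup>,\<^sup>2\<close> of the boundary.\<close>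

definition is_normal_deriv ::
    "real \<Rightarrow> (real \<times> real \<Rightarrow> real) \<Rightarrow> (real \<times> real \<Rightarrow> real) \<Rightarrow> bool" where
  "is_normal_deriv l v f \<longleftrightarrow> f \<in> W02_bdry (1/2) l \<and>
     (\<forall>u\<in>W12_quadrant 0 l. \<forall>h. is_trace l u h \<longrightarrow>
        (LINT y|area l. weak_grad (quadrant l) v y \<bullet> weak_grad (quadrant l) u y)
          = (LINT y|bdry_length l. f y * h y))"

end

theory Submission
  imports Defs
begin

text \<open>By Green's formula \<open>T\<close> is symmetric: \<open>\<integral> T(g) h = \<integral> \<nabla>v\<^sub>g \<bullet> \<nabla>v\<^sub>h = \<integral> g T(h)\<close>. The
  right-hand side makes sense for all \<open>g\<close> in \<open>W\<^sup>0\<^sup>,\<^sup>2\<close> with weight exponent \<open>-1/2\<close> and, by the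
  Cauchy-Schwarz inequality and the boundedness of \<open>T\<close>, is bounded in \<open>h\<close>; it defines the
  extension as the transpose of \<open>T\<close>.

  Applying linearity of \<open>T\<close> to a combination of elements of \<open>W\<^sup>1\<^sup>,\<^sup>2\<close> of the boundary requires that
  this set of representatives is closed under linear combinations. As \<open>tangential_deriv\<close> is an
  arbitrary choice of a weak derivative, this rests on the uniqueness of weak derivatives on the
  real line, hence on a supply of smooth test functions.\<close>

section \<open>Smooth functions of one real variable\<close>

text \<open>On the line the only basis vector is 1, so the Frechet derivatives in
  \<open>C_diff\<close> reduce to ordinary ones. This rule and its converse below let smoothness be
  propagated by induction on the order, with the derivative named explicitly.\<close>

lemma C_diff_real_SucI:
  fixes f f' :: "real \<Rightarrow> real"
  assumes "\<And>x. (f has_real_derivative f' x) (at x)" and "C_diff k f'"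
  shows "C_diff (Suc k) f"
proof -
  have "frechet_derivative f (at x) 1 = f' x" for x
    using frechet_derivative_at[OF assms(1)[of x, unfolded has_field_derivative_def]]
    by (metis mult.right_neutral)
  then show ?thesis
    using assms by (auto simp: real_differentiable_def intro: real_differentiableE)
qed

lemma C_diff_real_SucE:
  fixes f :: "real \<Rightarrow> real"
  assumes "C_diff (Suc k) f"
  shows "\<exists>f'. (\<forall>x. (f has_real_derivative f' x) (at x)) \<and> C_diff k f'"
proof (intro exI conjI allI)
  show "C_diff k (\<lambda>x. frechet_derivative f (at x) 1)"
    using assms by simp
  fix x
  have f: "(f has_derivative frechet_derivative f (at x)) (at x)"
    using assms by (simp add: frechet_derivative_works)
  then show "(f has_real_derivative frechet_derivative f (at x) 1) (at x)"
  proof (rule has_derivative_imp_has_field_derivative)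
    show "h * frechet_derivative f (at x) 1 = frechet_derivative f (at x) h" for h
      using linear_scale[OF has_derivative_linear[OF f], of h 1] by simp
  qed
qed

text \<open>The product rule keeps undifferentiated factors, so the induction for products has to
  lower the order of a factor.\<close>

lemma C_diff_real_SucD:
  fixes f :: "real \<Rightarrow> real"
  assumes "C_diff (Suc k) f"
  shows "C_diff k f"
  using assms
proof (induction k arbitrary: f)
  case 0
  then have "\<And>x. isCont f x"
    by (auto intro: differentiable_imp_continuous_within)
  then show ?case
    by (simp add: continuous_at_imp_continuous_on)
next
  case (Suc k)
  obtain f' where f': "\<And>x. (f has_real_derivative f' x) (at x)" "C_diff (Suc k) f'"
    using C_diff_real_SucE[OF Suc.prems] by blast
  then show ?case
    using C_diff_real_SucI[OF f'(1) Suc.IH[OF f'(2)]] by simp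
qed

lemma C_diff_real_const: "C_diff k (\<lambda>x::real. c)"
proof (induction k arbitrary: c)
  case (Suc k)
  show ?case
    by (rule C_diff_real_SucI[OF _ Suc.IH[of 0]]) auto
qed simp

lemma C_diff_real_add:
  fixes f g :: "real \<Rightarrow> real"
  assumes "C_diff k f" "C_diff k g"
  shows "C_diff k (\<lambda>x. f x + g x)"
  using assms
proof (induction k arbitrary: f g)
  case 0
  then show ?case by (auto intro: continuous_intros)
next
  case (Suc k)
  obtain f' where f': "\<And>x. (f has_real_derivative f' x) (at x)" "C_diff k f'"
    using C_diff_real_SucE[OF Suc.prems(1)] by blast
  obtain g' where g': "\<And>x. (g has_real_derivative g' x) (at x)" "C_diff k g'"
    using C_diff_real_SucE[OF Suc.prems(2)] by blast
  show ?case
    by (rule C_diff_real_SucI[OF _ Suc.IH[OF f'(2) g'(2)]]) (intro derivative_intros f' g')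
qed

lemma C_diff_real_mult:
  fixes f g :: "real \<Rightarrow> real"
  assumes "C_diff k f" "C_diff k g"
  shows "C_diff k (\<lambda>x. f x * g x)"
  using assms
proof (induction k arbitrary: f g)
  case 0
  then show ?case by (auto intro: continuous_intros)
next
  case (Suc k)
  obtain f' where f': "\<And>x. (f has_real_derivative f' x) (at x)" "C_diff k f'"
    using C_diff_real_SucE[OF Suc.prems(1)] by blast
  obtain g' where g': "\<And>x. (g has_real_derivative g' x) (at x)" "C_diff k g'"
    using C_diff_real_SucE[OF Suc.prems(2)] by blast
  have "C_diff k (\<lambda>x. f' x * g x + g' x * f x)"
    by (rule C_diff_real_add[OF Suc.IH[OF f'(2) C_diff_real_SucD[OF Suc.prems(2)]]
          Suc.IH[OF g'(2) C_diff_real_SucD[OF Suc.prems(1)]]])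
  then show ?case
    by (rule C_diff_real_SucI[rotated]) (intro DERIV_mult f' g')
qed

lemma C_diff_real_affine:
  fixes f :: "real \<Rightarrow> real"
  assumes "C_diff k f"
  shows "C_diff k (\<lambda>x. f (c * x + d))"
  using assms
proof (induction k arbitrary: f)
  case 0
  then show ?case
    by (auto intro!: continuous_intros intro: continuous_on_compose2[where g = f])
next
  case (Suc k)
  obtain f' where f': "\<And>x. (f has_real_derivative f' x) (at x)" "C_diff k f'"
    using C_diff_real_SucE[OF Suc.prems] by blast
  have "C_diff k (\<lambda>x. f' (c * x + d) * c)"
    using Suc f' by (intro C_diff_real_mult C_diff_real_const)
  then show ?case
  proof (rule C_diff_real_SucI[rotated])
    fix x
    show "((\<lambda>x. f (c * x + d)) has_real_derivative f' (c * x + d) * c) (at x)"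
      by (rule DERIV_chain2[OF f'(1)]) (auto intro!: derivative_eq_intros)
  qed
qed

section \<open>Bump functions and approximation of interval indicators\<close>

text \<open>The powers of \<open>inverse x\<close> make the span of this family closed under differentiation.\<close>

definition flat_exp :: "nat \<Rightarrow> real \<Rightarrow> real" where
  "flat_exp k x = (if x > 0 then exp (- inverse x) * inverse x ^ k else 0)"

text \<open>With u = \<open>inverse x\<close> this is the decay of \<open>u ^ k / exp u\<close> as u
  tends to infinity.\<close>

lemma tendsto_flat_exp_at_right_0: "(flat_exp k \<longlongrightarrow> 0) (at_right 0)"
proof -
  have "((\<lambda>x. inverse x ^ k / exp (inverse x)) \<longlongrightarrow> (0::real)) (at_right 0)"
    by (rule filterlim_compose[OF tendsto_power_div_exp_0 filterlim_inverse_at_top_right])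
  moreover have "eventually (\<lambda>x. inverse x ^ k / exp (inverse x) = flat_exp k x) (at_right 0)"
    using eventually_at_right_less[of 0]
    by eventually_elim (simp add: flat_exp_def exp_minus field_simps)
  ultimately show ?thesis
    by (rule Lim_transform_eventually)
qed

text \<open>Away from 0 this is the product rule or the derivative of a constant. At 0 the right
  difference quotient \<open>flat_exp k y / y\<close> equals \<open>flat_exp (Suc k) y\<close>,
  which tends to 0, and the left one is 0.\<close>

lemma DERIV_flat_exp:
  "(flat_exp k has_real_derivative flat_exp (k + 2) x + - real k * flat_exp (k + 1) x) (at x)"
proof (cases x "0 :: real" rule: linorder_cases)
  case greater
  have "((\<lambda>x. inverse x ^ k) has_real_derivative
      real k * (- (inverse x ^ Suc (Suc 0)) * inverse x ^ (k - Suc 0))) (at x)"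
    using greater by (intro DERIV_power DERIV_inverse) simp
  \<comment> \<open>\<open>k - Suc 0\<close> is truncated subtraction; for \<open>k = 0\<close> the
    factor \<open>real k\<close> makes both sides vanish.\<close>
  moreover have "real k * (- (inverse x ^ Suc (Suc 0)) * inverse x ^ (k - Suc 0))
      = - real k * inverse x ^ (k + 1)"
    by (cases k) (simp_all add: algebra_simps)
  ultimately have 1: "((\<lambda>x. inverse x ^ k) has_real_derivative - real k * inverse x ^ (k + 1)) (at x)"
    by (simp only:)
  have 2: "((\<lambda>x. exp (- inverse x)) has_real_derivative exp (- inverse x) * (inverse x * inverse x)) (at x)"
    using greater by (auto intro!: derivative_eq_intros)
  have "exp (- inverse x) * (inverse x * inverse x) * inverse x ^ k
        + - real k * inverse x ^ (k + 1) * exp (- inverse x)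
      = flat_exp (k + 2) x + - real k * flat_exp (k + 1) x"
    using greater by (simp add: flat_exp_def algebra_simps)
  with DERIV_mult[OF 2 1] have "((\<lambda>x. exp (- inverse x) * inverse x ^ k) has_real_derivative
      flat_exp (k + 2) x + - real k * flat_exp (k + 1) x) (at x)"
    by (simp only:)
  then show ?thesis
    by (rule has_field_derivative_transform_within_open[where S = "{0<..}"])
      (use greater in \<open>auto simp: flat_exp_def\<close>)
next
  case less
  have "((\<lambda>x. 0) has_real_derivative flat_exp (k + 2) x + - real k * flat_exp (k + 1) x) (at x)"
    using less by (simp add: flat_exp_def)
  then show ?thesis
    by (rule has_field_derivative_transform_within_open[where S = "{..<0}"])
      (use less in \<open>auto simp: flat_exp_def\<close>)
next
  case equal
  have "((\<lambda>y. flat_exp k y / y) \<longlongrightarrow> 0) (at_right 0)"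
  proof (rule Lim_transform_eventually[OF tendsto_flat_exp_at_right_0[of "Suc k"]])
    show "eventually (\<lambda>x. flat_exp (Suc k) x = flat_exp k x / x) (at_right 0)"
      by (simp add: flat_exp_def field_simps)
  qed
  moreover have "((\<lambda>y. flat_exp k y / y) \<longlongrightarrow> 0) (at_left 0)"
    by (intro tendsto_eventually) (auto simp: flat_exp_def eventually_at_filter)
  ultimately show ?thesis
    using equal by (simp add: has_field_derivative_iff flat_exp_def filterlim_at_split)
qed

lemma C_diff_flat_exp: "C_diff n (flat_exp k)"
proof (induction n arbitrary: k)
  case 0
  show ?case
    by (auto intro!: continuous_at_imp_continuous_on DERIV_isCont[OF DERIV_flat_exp])
next
  case (Suc n)
  show ?case
    by (rule C_diff_real_SucI[OF DERIV_flat_exp])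
      (intro C_diff_real_add C_diff_real_mult C_diff_real_const Suc.IH)
qed

text \<open>For n > 0 the functions are exp(-1/(n(x-a))) exp(-1/(n(b-x))) inside the interval: both
  factors lie between 0 and 1 and tend to 1 as n grows. Outside the interval one of the two factors
  vanishes.\<close>

lemma indicator_interval_limit_of_test_functions:
  fixes a b :: real
  obtains \<phi> where "\<And>n. \<phi> n \<in> test_functions UNIV"
    and "\<And>n x. 0 \<le> \<phi> n x" and "\<And>n x. \<phi> n x \<le> indicator {a<..<b} x"
    and "\<And>x. (\<lambda>n. \<phi> n x) \<longlonglongrightarrow> indicator {a<..<b} x"
proof
  define \<phi> where
    "\<phi> n x = flat_exp 0 (real n * x + - real n * a) * flat_exp 0 (- real n * x + real n * b)"
    for n x
  \<comment> \<open>\<open>r = 0\<close> is included because the sequence starts at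
    \<open>n = 0\<close>, where it is the zero function.\<close>
  have pos: "0 < r * x + - r * a \<longleftrightarrow> 0 < r \<and> a < x" "0 < - r * x + r * b \<longleftrightarrow> 0 < r \<and> x < b"
    if "0 \<le> r" for r x :: real
    using that mult_less_cancel_left[of r a x] mult_less_cancel_left[of r x b] by auto
  have le1: "0 \<le> flat_exp 0 x" "flat_exp 0 x \<le> 1" for x
    by (auto simp: flat_exp_def)
  show "0 \<le> \<phi> n x" for n x
    by (simp add: \<phi>_def le1)
  have zero: "\<phi> n x = 0" if "x \<notin> {a<..<b}" for n x
  proof -
    have "\<not> 0 < real n * x + - real n * a \<or> \<not> 0 < - real n * x + real n * b"
      using that pos[of "real n" x] by auto
    then show ?thesis
      unfolding \<phi>_def flat_exp_def by auto
  qed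
  show "\<phi> n x \<le> indicator {a<..<b} x" for n x
  proof (cases "x \<in> {a<..<b}")
    case True
    then show ?thesis
      unfolding \<phi>_def using le1 by (simp add: mult_le_one)
  qed (simp add: zero)
  show "\<phi> n \<in> test_functions UNIV" for n
  proof -
    have "{x. \<phi> n x \<noteq> 0} \<subseteq> {a<..<b}"
      using zero by blast
    also have "\<dots> \<subseteq> {a..b}"
      by auto
    finally have "closure {x. \<phi> n x \<noteq> 0} \<subseteq> {a..b}"
      by (rule closure_minimal) simp
    then have "compact (closure {x. \<phi> n x \<noteq> 0})"
      by (meson bounded_closed_interval bounded_subset closed_closure compact_eq_bounded_closed)
    moreover have "C_diff k (\<phi> n)" for k
      unfolding \<phi>_def[abs_def]
      by (intro C_diff_real_mult C_diff_real_affine C_diff_flat_exp)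
    ultimately show ?thesis
      by (simp add: test_functions_def)
  qed
  have lim: "(\<lambda>n. flat_exp 0 (real n * c)) \<longlonglongrightarrow> 1" if "0 < c" for c
  proof -
    have "(\<lambda>n. exp (- (inverse (real n) * inverse c))) \<longlonglongrightarrow> exp (- (0 * inverse c))"
      by (intro tendsto_intros lim_inverse_n)
    moreover have "eventually (\<lambda>n. exp (- (inverse (real n) * inverse c)) = flat_exp 0 (real n * c))
        sequentially"
      using eventually_gt_at_top[of 0] by eventually_elim (use that in \<open>simp add: flat_exp_def\<close>)
    ultimately show ?thesis
      by (auto intro: Lim_transform_eventually)
  qed
  show "(\<lambda>n. \<phi> n x) \<longlonglongrightarrow> indicator {a<..<b} x" for x
  proof (cases "x \<in> {a<..<b}")
    case True
    have "(\<lambda>n. flat_exp 0 (real n * (x - a)) * flat_exp 0 (real n * (b - x))) \<longlonglongrightarrow> 1 * 1"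
      using True by (intro tendsto_mult lim) auto
    then show ?thesis
      using True by (simp add: \<phi>_def algebra_simps)
  qed (simp add: zero)
qed

section \<open>Local integrability, test functions and linearity of weak gradients\<close>

text \<open>Integrability on each ball of integer radius gives measurability there, and countably
  many such balls cover the space.\<close>

lemma locally_integrable_UNIV_measurable:
  fixes f :: "'a::euclidean_space \<Rightarrow> 'b::euclidean_space"
  assumes "locally_integrable UNIV f"
  shows "f \<in> borel_measurable borel"
proof (rule measurable_piecewise_restrict2[where A = "\<lambda>n. cball 0 (real n)"])
  show "space borel = (\<Union>n. cball (0::'a) (real n))"
    by (auto simp: real_arch_simple)
  fix n
  have "(\<lambda>x. indicat_real (cball 0 (real n)) x *\<^sub>R f x) \<in> borel_measurable borel"
    using assms by (auto simp: locally_integrable_def set_integrable_def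
        dest!: spec[of _ "cball 0 (real n)"] borel_measurable_integrable)
  then show "\<exists>h\<in>borel_measurable borel. \<forall>x\<in>cball 0 (real n). f x = h x"
    by (rule rev_bexI) simp
qed auto

lemma locally_integrable_lincomb:
  assumes "locally_integrable U f" "locally_integrable U g"
  shows "locally_integrable U (\<lambda>x. a *\<^sub>R f x + b *\<^sub>R g x)"
  using assms unfolding locally_integrable_def
  by (auto intro!: set_integral_add set_integrable_scaleR_right)

text \<open>The continuous factor is bounded on the compact set \<open>K\<close> and vanishes off
  it, so a multiple of \<open>f\<close> restricted to \<open>K\<close> dominates the
  product.\<close>

lemma set_integrable_locally_integrable_mult:
  fixes f \<psi> :: "'a::euclidean_space \<Rightarrow> real"
  assumes f: "locally_integrable U f" and K: "compact K" "K \<subseteq> U"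
    and \<psi>: "continuous_on UNIV \<psi>" "\<And>x. x \<notin> K \<Longrightarrow> \<psi> x = 0"
  shows "set_integrable lborel U (\<lambda>x. f x * \<psi> x)"
proof -
  have "bounded (\<psi> ` K)"
    using K \<psi> by (meson compact_continuous_image compact_imp_bounded continuous_on_subset
        subset_UNIV)
  then obtain C where C: "\<And>x. x \<in> K \<Longrightarrow> \<bar>\<psi> x\<bar> \<le> C"
    by (auto simp: bounded_iff)
  have fK: "integrable lborel (\<lambda>x. indicator K x *\<^sub>R f x)"
    using f K by (auto simp: locally_integrable_def set_integrable_def)
  have [measurable]: "\<psi> \<in> borel_measurable borel"
    using \<psi>(1) by (rule borel_measurable_continuous_onI)
  have "integrable lborel (\<lambda>x. (indicator K x *\<^sub>R f x) * \<psi> x)"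
  proof (rule Bochner_Integration.integrable_bound)
    show "integrable lborel (\<lambda>x. C * (indicator K x *\<^sub>R f x))"
      using fK by simp
    show "(\<lambda>x. indicator K x *\<^sub>R f x * \<psi> x) \<in> borel_measurable lborel"
      using borel_measurable_integrable[OF fK] by measurable
    show "AE x in lborel. norm (indicator K x *\<^sub>R f x * \<psi> x) \<le> norm (C * indicator K x *\<^sub>R f x)"
    proof (rule AE_I2)
      fix x
      show "norm (indicator K x *\<^sub>R f x * \<psi> x) \<le> norm (C * indicator K x *\<^sub>R f x)"
        using C[of x] by (cases "x \<in> K") (auto simp: abs_mult mult.commute intro!: mult_right_mono)
    qed
  qed
  moreover have "indicator K x *\<^sub>R f x * \<psi> x = indicator U x *\<^sub>R (f x * \<psi> x)" for x
    using K \<psi>(2)[of x] by (cases "x \<in> K") auto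
  ultimately show ?thesis
    by (simp only: set_integrable_def)
qed

lemma test_function_set_integrable:
  fixes f :: "'a::euclidean_space \<Rightarrow> real"
  assumes f: "locally_integrable U f" and \<phi>: "\<phi> \<in> test_functions U"
  shows "set_integrable lborel U (\<lambda>x. f x * \<phi> x)"
    and "i \<in> Basis \<Longrightarrow> set_integrable lborel U (\<lambda>x. f x * frechet_derivative \<phi> (at x) i)"
proof -
  define K where "K = closure {x. \<phi> x \<noteq> 0}"
  have K: "compact K" "K \<subseteq> U" and C: "C_diff 0 \<phi>" "C_diff (Suc 0) \<phi>"
    using \<phi> unfolding test_functions_def K_def by blast+
  have zero: "\<phi> x = 0" if "x \<notin> K" for x
    using that closure_subset[of "{x. \<phi> x \<noteq> 0}"] unfolding K_def by blast
  show "set_integrable lborel U (\<lambda>x. f x * \<phi> x)"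
    by (rule set_integrable_locally_integrable_mult[OF f K, where \<psi> = \<phi>])
      (use C(1) zero in \<open>auto simp only: C_diff.simps\<close>)
  \<comment> \<open>The complement of the closed support is open and \<phi> is constant on it, so
    the derivative has its support in \<open>K\<close> as well.\<close>
  have deriv_zero: "frechet_derivative \<phi> (at x) = (\<lambda>h. 0)" if "x \<notin> K" for x
  proof -
    have "((\<lambda>x. 0) has_derivative (\<lambda>h. 0)) (at x)"
      by (rule has_derivative_const)
    then have "(\<phi> has_derivative (\<lambda>h. 0)) (at x)"
      by (rule has_derivative_transform_within_open[where s = "- K"])
        (use that zero compact_imp_closed[OF K(1)] in auto)
    then show ?thesis
      by (metis frechet_derivative_at)
  qed
  show "set_integrable lborel U (\<lambda>x. f x * frechet_derivative \<phi> (at x) i)" if "i \<in> Basis"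
  proof (rule set_integrable_locally_integrable_mult[OF f K])
    show "continuous_on UNIV (\<lambda>x. frechet_derivative \<phi> (at x) i)"
      using C(2) that by (simp only: C_diff.simps)
    show "frechet_derivative \<phi> (at x) i = 0" if "x \<notin> K" for x
      using deriv_zero[OF that] by simp
  qed
qed

lemma locally_integrable_inner:
  assumes "locally_integrable U G"
  shows "locally_integrable U (\<lambda>x. G x \<bullet> i)"
proof -
  have "integrable lborel (\<lambda>x. (indicator K x *\<^sub>R G x) \<bullet> i)" if "compact K" "K \<subseteq> U" for K
    using assms that
    by (intro integrable_inner_left) (simp add: locally_integrable_def set_integrable_def)
  then show ?thesis
    by (simp add: locally_integrable_def set_integrable_def)
qed

text \<open>The defining identity is linear once all the integrals involved exist, which the
  integrability against test functions ensures. It serves both the closure of the boundary space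
  under combinations and the uniqueness of weak derivatives, where the coefficients are 1 and
  -1.\<close>

lemma is_weak_gradient_lincomb:
  assumes "is_weak_gradient U f F" "is_weak_gradient U g G"
  shows "is_weak_gradient U (\<lambda>x. a * f x + b * g x) (\<lambda>x. a *\<^sub>R F x + b *\<^sub>R G x)"
  unfolding is_weak_gradient_def
proof (intro conjI ballI)
  have loc: "locally_integrable U f" "locally_integrable U g"
    "locally_integrable U F" "locally_integrable U G"
    using assms by (auto simp: is_weak_gradient_def)
  show "locally_integrable U (\<lambda>x. a * f x + b * g x)"
    using locally_integrable_lincomb[OF loc(1,2)] by simp
  show "locally_integrable U (\<lambda>x. a *\<^sub>R F x + b *\<^sub>R G x)"
    by (intro locally_integrable_lincomb loc)
  fix \<phi> and i :: 'a
  assume \<phi>: "\<phi> \<in> test_functions U" and i: "i \<in> Basis"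
  let ?d = "\<lambda>x. frechet_derivative \<phi> (at x) i"
  note int = test_function_set_integrable[OF loc(1) \<phi>] test_function_set_integrable[OF loc(2) \<phi>]
    test_function_set_integrable[OF locally_integrable_inner[OF loc(3)] \<phi>]
    test_function_set_integrable[OF locally_integrable_inner[OF loc(4)] \<phi>]
  have "(LINT x:U|lborel. (a * f x + b * g x) * ?d x)
      = (LINT x:U|lborel. a * (f x * ?d x) + b * (g x * ?d x))"
    by (simp add: algebra_simps)
  also have "\<dots> = a * (LINT x:U|lborel. f x * ?d x) + b * (LINT x:U|lborel. g x * ?d x)"
    using int i by (simp add: set_integral_add)
  also have "\<dots> = - (a * (LINT x:U|lborel. (F x \<bullet> i) * \<phi> x) + b * (LINT x:U|lborel. (G x \<bullet> i) * \<phi> x))"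
    using assms \<phi> i by (simp add: is_weak_gradient_def)
  also have "a * (LINT x:U|lborel. (F x \<bullet> i) * \<phi> x) + b * (LINT x:U|lborel. (G x \<bullet> i) * \<phi> x)
      = (LINT x:U|lborel. a * ((F x \<bullet> i) * \<phi> x) + b * ((G x \<bullet> i) * \<phi> x))"
    using int by (simp add: set_integral_add)
  also have "\<dots> = (LINT x:U|lborel. ((a *\<^sub>R F x + b *\<^sub>R G x) \<bullet> i) * \<phi> x)"
    by (simp add: algebra_simps)
  finally show "(LINT x:U|lborel. (a * f x + b * g x) * ?d x)
      = - (LINT x:U|lborel. ((a *\<^sub>R F x + b *\<^sub>R G x) \<bullet> i) * \<phi> x)" .
qed

section \<open>Uniqueness of weak derivatives on the line\<close>

text \<open>On a bounded interval the positive and negative parts of \<open>G\<close> are densities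
  of two measures that agree on all half-lines and are finite there. The measures are therefore
  equal, the densities agree almost everywhere, and a number whose positive and negative parts
  coincide is 0.\<close>

lemma AE_zero_if_interval_integrals_zero:
  fixes G :: "real \<Rightarrow> real"
  assumes G: "locally_integrable UNIV G"
    and zero: "\<And>a b. (LINT x:{a<..<b}|lborel. G x) = 0"
  shows "AE x in lborel. G x = 0"
proof -
  have [measurable]: "G \<in> borel_measurable borel"
    by (rule locally_integrable_UNIV_measurable[OF G])
  have "AE x in lborel. x \<in> {- r<..<r} \<longrightarrow> G x = 0" for r
  proof -
    define g where "g x = indicator {- r<..<r} x * G x" for x
    have [measurable]: "g \<in> borel_measurable borel"
      unfolding g_def by measurable
    have "set_integrable lborel {- r..r} G"
      using G by (simp add: locally_integrable_def)
    then have "set_integrable lborel {- r<..<r} G"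
      by (rule set_integrable_subset) auto
    then have g: "integrable lborel g"
      by (simp add: set_integrable_def g_def[abs_def])
    have gs: "integrable lborel (\<lambda>x. max 0 (s * g x) * indicator A x)"
      if [measurable]: "A \<in> sets borel" for A s
      using g by (intro integrable_real_mult_indicator integrable_max) auto
    \<comment> \<open>Cutting a half-line down to the support of \<open>g\<close> leaves a bounded
      open interval, possibly empty.\<close>
    have gA: "(LINT x|lborel. g x * indicator {c<..} x) = 0" for c
      using zero[of "max c (- r)" r]
      by (auto simp: g_def set_lebesgue_integral_def indicator_def
          intro!: arg_cong[where f = "lebesgue_integral lborel"] elim!: trans[rotated])
    let ?M = "\<lambda>s. density lborel (\<lambda>x. ennreal (max 0 (s * g x)))"
    have em: "emeasure (?M s) A = ennreal (LINT x|lborel. max 0 (s * g x) * indicator A x)"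
      if [measurable]: "A \<in> sets borel" for A s
      by (subst emeasure_density)
        (auto simp: ennreal_mult'[symmetric] ennreal_indicator[symmetric]
          intro!: nn_integral_eq_integral gs that)
    have "?M 1 = ?M (- 1)"
    proof (rule measure_eqI_lessThan)
      fix c
      show "emeasure (?M 1) {c<..} < \<infinity>"
        by (subst em) auto
      have "(LINT x|lborel. max 0 (1 * g x) * indicator {c<..} x)
          - (LINT x|lborel. max 0 (- 1 * g x) * indicator {c<..} x)
          = (LINT x|lborel. max 0 (1 * g x) * indicator {c<..} x
              - max 0 (- 1 * g x) * indicator {c<..} x)"
        by (rule Bochner_Integration.integral_diff[symmetric]; rule gs) auto
      also have "\<dots> = (LINT x|lborel. g x * indicator {c<..} x)"
        by (rule Bochner_Integration.integral_cong) (auto simp: max_def indicator_def)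
      finally show "emeasure (?M 1) {c<..} = emeasure (?M (- 1)) {c<..}"
        using gA[of c] by (subst (1 2) em) simp_all
    qed auto
    then have "AE x in lborel. ennreal (max 0 (1 * g x)) = ennreal (max 0 (- 1 * g x))"
      by (intro sigma_finite_measure.density_unique[OF sigma_finite_lborel]) auto
    then show ?thesis
      by eventually_elim (auto simp: g_def max_def split: if_splits)
  qed
  then have "AE x in lborel. \<forall>n. x \<in> {- real n<..<real n} \<longrightarrow> G x = 0"
    unfolding AE_all_countable by blast
  then show ?thesis
  proof eventually_elim
    case (elim x)
    obtain n where "\<bar>x\<bar> < real n"
      using reals_Archimedean2 by blast
    then show ?case
      using elim[rule_format, of n] by (simp add: abs_less_iff)
  qed
qed

text \<open>The difference of two weak derivatives is a weak derivative of 0, so it integrates to 0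
  against every test function. Letting test functions increase to the indicator of an interval in
  the sense of dominated convergence gives vanishing integrals over intervals.\<close>

lemma is_weak_gradient_real_unique:
  fixes v G H :: "real \<Rightarrow> real"
  assumes "is_weak_gradient UNIV v G" "is_weak_gradient UNIV v H"
  shows "AE x in lborel. G x = H x"
proof -
  define D where "D x = 1 *\<^sub>R G x + (- 1) *\<^sub>R H x" for x
  have wD: "is_weak_gradient UNIV (\<lambda>x. 1 * v x + (- 1) * v x) D"
    unfolding D_def by (rule is_weak_gradient_lincomb[OF assms])
  then have D: "locally_integrable UNIV D"
    by (simp add: is_weak_gradient_def)
  have [measurable]: "D \<in> borel_measurable borel"
    by (rule locally_integrable_UNIV_measurable[OF D])
  \<comment> \<open>The function with weak derivative \<open>D\<close> is
    \<open>1 * v x + (- 1) * v x\<close>, so the other side of the defining identity is 0.\<close>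
  have test: "(LINT x|lborel. D x * \<phi> x) = 0" if "\<phi> \<in> test_functions UNIV" for \<phi>
    using wD that by (auto simp: is_weak_gradient_def set_lebesgue_integral_def)
  have "AE x in lborel. D x = 0"
  proof (rule AE_zero_if_interval_integrals_zero[OF D])
    fix a b :: real
    obtain \<phi> where \<phi>: "\<And>n. \<phi> n \<in> test_functions UNIV"
      "\<And>n x. 0 \<le> \<phi> n x" "\<And>n x. \<phi> n x \<le> indicator {a<..<b} x"
      "\<And>x. (\<lambda>n. \<phi> n x) \<longlonglongrightarrow> indicator {a<..<b} x"
      using indicator_interval_limit_of_test_functions[of a b] by blast
    have [measurable]: "\<phi> n \<in> borel_measurable borel" for n
    proof -
      have "C_diff 0 (\<phi> n)"
        using \<phi>(1) unfolding test_functions_def by blast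
      then show ?thesis
        by (simp add: borel_measurable_continuous_onI)
    qed
    have "(\<lambda>n. LINT x|lborel. D x * \<phi> n x) \<longlonglongrightarrow> (LINT x|lborel. D x * indicator {a<..<b} x)"
    proof (rule integral_dominated_convergence)
      have "set_integrable lborel {a..b} D"
        using D by (simp add: locally_integrable_def)
      then have "set_integrable lborel {a<..<b} D"
        by (rule set_integrable_subset) auto
      then show "integrable lborel (\<lambda>x. norm (indicator {a<..<b} x *\<^sub>R D x))"
        unfolding set_integrable_def by (rule integrable_norm)
      show "AE x in lborel. (\<lambda>n. D x * \<phi> n x) \<longlonglongrightarrow> D x * indicator {a<..<b} x"
        by (intro AE_I2 tendsto_mult tendsto_const \<phi>)
      show "AE x in lborel. norm (D x * \<phi> n x) \<le> norm (indicator {a<..<b} x *\<^sub>R D x)" for n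
        using \<phi>(2,3)[of n] by (intro AE_I2) (simp add: abs_mult mult.commute mult_left_mono)
    qed auto
    then show "(LINT x:{a<..<b}|lborel. D x) = 0"
      using LIMSEQ_unique[OF _ tendsto_const[of 0]]
      by (simp add: test[OF \<phi>(1)] set_lebesgue_integral_def mult.commute)
  qed
  then show ?thesis
    by eventually_elim (simp add: D_def)
qed

lemma is_weak_gradient_weak_grad:
  "weakly_differentiable U v \<Longrightarrow> is_weak_gradient U v (weak_grad U v)"
  unfolding weakly_differentiable_def weak_grad_def by (metis someI_ex)

section \<open>The arc length measure and the weights\<close>

lemma measurable_bdry_point [measurable]: "bdry_point l \<in> borel_measurable borel"
  unfolding bdry_point_def[abs_def] by measurable

lemma sets_bdry_length [simp, measurable_cong]: "sets (bdry_length l) = sets borel"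
  by (simp add: bdry_length_def)

lemma measurable_arc_coord [measurable]: "arc_coord l \<in> borel_measurable borel"
  unfolding arc_coord_def[abs_def]
  by (intro borel_measurable_continuous_onI continuous_intros)

lemma measurable_weight [measurable]: "weight \<alpha> \<in> borel_measurable borel"
  unfolding weight_def[abs_def] by measurable

lemma weight_pos: "0 < weight \<alpha> y"
  using zero_le_power2[of "norm y"] by (simp add: weight_def add_nonneg_eq_0_iff)

text \<open>The exceptional set is first enlarged to a Borel null set \<open>N\<close>, since
  \<open>P\<close> itself need not be measurable, while passing to the image measure calls for a
  measurable event.\<close>

lemma AE_bdry_length_arc_coord:
  assumes "AE t in lborel. P t"
  shows "AE y in bdry_length l. P (arc_coord l y)"
proof -
  obtain N where N: "{t. \<not> P t} \<subseteq> N" "N \<in> sets borel" "emeasure lborel N = 0"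
    using assms by (auto elim: AE_E)
  then have "AE t in lborel. t \<notin> N"
    by (auto intro!: AE_not_in simp: null_sets_def)
  then have "AE t in lborel. arc_coord l (bdry_point l t) \<notin> N"
    by simp
  moreover have "{y \<in> space borel. arc_coord l y \<notin> N} \<in> sets borel"
    using N(2) by measurable
  ultimately have "AE y in bdry_length l. arc_coord l y \<notin> N"
    unfolding bdry_length_def by (subst AE_distr_iff) auto
  then show ?thesis
    by eventually_elim (use N(1) in blast)
qed

section \<open>Weighted square-integrable functions and their duality\<close>

lemma weighted_L2_lincomb:
  assumes w: "\<And>x. 0 \<le> w x" "w \<in> borel_measurable M"
    and f: "f \<in> weighted_L2 M w" and g: "g \<in> weighted_L2 M w"
  shows "(\<lambda>x. a * f x + b * g x) \<in> weighted_L2 M w"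
proof -
  have [measurable]: "f \<in> borel_measurable M" "g \<in> borel_measurable M" "w \<in> borel_measurable M"
    using f g w by (auto simp: weighted_L2_def)
  have "integrable M (\<lambda>x. w x * (a * f x + b * g x)\<^sup>2)"
  proof (rule Bochner_Integration.integrable_bound)
    show "integrable M (\<lambda>x. 2 * a\<^sup>2 * (w x * (f x)\<^sup>2) + 2 * b\<^sup>2 * (w x * (g x)\<^sup>2))"
      using f g by (auto simp: weighted_L2_def)
    have "w x * (a * f x + b * g x)\<^sup>2 \<le> 2 * a\<^sup>2 * (w x * (f x)\<^sup>2) + 2 * b\<^sup>2 * (w x * (g x)\<^sup>2)" for x
    proof -
      have "(a * f x + b * g x)\<^sup>2 \<le> 2 * (a * f x)\<^sup>2 + 2 * (b * g x)\<^sup>2"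
        using sum_squares_bound[of "a * f x" "b * g x"] by (simp add: power2_sum)
      from mult_left_mono[OF this w(1)[of x]] show ?thesis
        by (simp add: algebra_simps power_mult_distrib)
    qed
    then show "AE x in M. norm (w x * (a * f x + b * g x)\<^sup>2)
        \<le> norm (2 * a\<^sup>2 * (w x * (f x)\<^sup>2) + 2 * b\<^sup>2 * (w x * (g x)\<^sup>2))"
      using w(1) by (intro AE_I2) (simp add: abs_of_nonneg order_trans[OF _ abs_ge_self])
  qed measurable
  then show ?thesis
    by (simp add: weighted_L2_def)
qed

lemma AE_zero_if_weighted_L2_norm_zero:
  assumes "\<And>x. 0 < w x" "f \<in> weighted_L2 M w" "weighted_L2_norm M w f = 0"
  shows "AE x in M. f x = 0"
proof -
  have "AE x in M. w x * (f x)\<^sup>2 = 0"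
    using assms integral_nonneg_eq_0_iff_AE[of M "\<lambda>x. w x * (f x)\<^sup>2"]
    by (simp add: weighted_L2_def weighted_L2_norm_def less_imp_le)
  then show ?thesis
    by eventually_elim (use assms(1) in \<open>auto simp: less_le\<close>)
qed

text \<open>Cauchy-Schwarz for reciprocal weights: Young's inequality with a free parameter
  \<open>t\<close> is integrated, and \<open>t\<close> is chosen afterwards.\<close>

lemma integrable_mult_dual_weights:
  assumes ww: "\<And>x. 0 \<le> w x" "\<And>x. 0 \<le> w' x" "\<And>x. w x * w' x = 1"
    and f: "f \<in> weighted_L2 M w" and g: "g \<in> weighted_L2 M w'"
  shows "integrable M (\<lambda>x. f x * g x)"
    and "\<bar>LINT x|M. f x * g x\<bar> \<le> weighted_L2_norm M w f * weighted_L2_norm M w' g"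
proof -
  have [measurable]: "f \<in> borel_measurable M" "g \<in> borel_measurable M"
    using f g by (auto simp: weighted_L2_def)
  have young: "2 * \<bar>f x * g x\<bar> \<le> t * (w x * (f x)\<^sup>2) + inverse t * (w' x * (g x)\<^sup>2)"
    if "0 < t" for t x
  proof -
    let ?p = "sqrt (t * w x) * \<bar>f x\<bar>" and ?q = "sqrt (inverse t * w' x) * \<bar>g x\<bar>"
    have "sqrt (t * w x) * sqrt (inverse t * w' x) = 1"
      using that ww[of x] by (simp add: real_sqrt_mult[symmetric] field_simps)
    then have "?p * ?q = \<bar>f x * g x\<bar>"
      by (metis (no_types, opaque_lifting) abs_mult mult.assoc mult.left_commute mult_1)
    moreover have "?p\<^sup>2 = t * (w x * (f x)\<^sup>2)" "?q\<^sup>2 = inverse t * (w' x * (g x)\<^sup>2)"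
      using that ww(1,2)[of x] by (simp_all add: power_mult_distrib)
    ultimately show ?thesis
      using sum_squares_bound[of ?p ?q] by (simp add: mult.assoc)
  qed
  have int: "integrable M (\<lambda>x. w x * (f x)\<^sup>2)" "integrable M (\<lambda>x. w' x * (g x)\<^sup>2)"
    using f g by (auto simp: weighted_L2_def)
  show fg: "integrable M (\<lambda>x. f x * g x)"
  proof (rule Bochner_Integration.integrable_bound)
    show "integrable M (\<lambda>x. w x * (f x)\<^sup>2 + w' x * (g x)\<^sup>2)"
      using int by simp
    show "AE x in M. norm (f x * g x) \<le> norm (w x * (f x)\<^sup>2 + w' x * (g x)\<^sup>2)"
    proof (rule AE_I2)
      fix x
      have "\<bar>f x * g x\<bar> \<le> w x * (f x)\<^sup>2 + w' x * (g x)\<^sup>2"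
        using young[of 1 x] by simp
      then show "norm (f x * g x) \<le> norm (w x * (f x)\<^sup>2 + w' x * (g x)\<^sup>2)"
        by simp
    qed
  qed measurable
  define A B J where "A = (LINT x|M. w x * (f x)\<^sup>2)" and "B = (LINT x|M. w' x * (g x)\<^sup>2)"
    and "J = (LINT x|M. \<bar>f x * g x\<bar>)"
  have AB: "0 \<le> A" "0 \<le> B" "0 \<le> J"
    unfolding A_def B_def J_def using ww by (auto intro!: integral_nonneg_AE)
  have J: "2 * J \<le> t * A + inverse t * B" if "0 < t" for t
  proof -
    have "(LINT x|M. 2 * \<bar>f x * g x\<bar>)
        \<le> (LINT x|M. t * (w x * (f x)\<^sup>2) + inverse t * (w' x * (g x)\<^sup>2))"
      using int fg young[OF that] by (intro integral_mono) auto
    then show ?thesis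
      using int by (simp add: A_def B_def J_def)
  qed
  have "J \<le> sqrt A * sqrt B"
  proof (rule field_le_epsilon)
    fix e :: real
    assume "0 < e"
    \<comment> \<open>The minimizing choice is \<open>sqrt B / sqrt A\<close>, which makes both
      summands equal to \<open>sqrt A * sqrt B\<close>. If \<open>A\<close> or \<open>B\<close> is 0
      this choice degenerates, and \<open>t\<close> is taken so large or so small that the remaining
      summand is at most \<open>2 * e\<close>.\<close>
    have "\<exists>t>0. t * A + inverse t * B \<le> 2 * (sqrt A * sqrt B) + 2 * e"
    proof (cases "A = 0 \<or> B = 0")
      case True
      then show ?thesis
      proof
        assume "A = 0"
        then show ?thesis
          using AB \<open>0 < e\<close> by (intro exI[of _ "(B + 1) / (2 * e)"]) (auto simp: field_simps)
      next
        assume "B = 0"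
        then show ?thesis
          using AB \<open>0 < e\<close> by (intro exI[of _ "2 * e / (A + 1)"]) (auto simp: field_simps)
      qed
    next
      case False
      then have "0 < A" "0 < B"
        using AB by auto
      moreover have "sqrt B / sqrt A * A = sqrt A * sqrt B" "sqrt A / sqrt B * B = sqrt A * sqrt B"
        using \<open>0 < A\<close> \<open>0 < B\<close> by (simp_all add: real_div_sqrt field_simps)
      ultimately show ?thesis
        using \<open>0 < e\<close> by (intro exI[of _ "sqrt B / sqrt A"]) auto
    qed
    then show "J \<le> sqrt A * sqrt B + e"
      using J by force
  qed
  then show "\<bar>LINT x|M. f x * g x\<bar> \<le> weighted_L2_norm M w f * weighted_L2_norm M w' g"
    unfolding A_def B_def J_def weighted_L2_norm_def
    by (rule order_trans[OF integral_abs_bound])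
qed

section \<open>Tangential derivatives and the boundary space\<close>

text \<open>The choice made by \<open>weak_grad\<close> can differ from \<open>H\<close> only on a
  null set of parameters, and such a set corresponds to a null set of the boundary.\<close>

lemma tangential_deriv_AE:
  assumes "is_weak_gradient UNIV (h \<circ> bdry_point l) H"
  shows "AE y in bdry_length l. tangential_deriv l h y = H (arc_coord l y)"
proof -
  have "weakly_differentiable UNIV (h \<circ> bdry_point l)"
    using assms unfolding weakly_differentiable_def by blast
  from is_weak_gradient_real_unique[OF is_weak_gradient_weak_grad[OF this] assms]
  show ?thesis
    unfolding tangential_deriv_def by (rule AE_bdry_length_arc_coord)
qed

lemma measurable_tangential_deriv:
  assumes "weakly_differentiable UNIV (h \<circ> bdry_point l)"
  shows "tangential_deriv l h \<in> borel_measurable borel"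
proof -
  have [measurable]: "weak_grad UNIV (h \<circ> bdry_point l) \<in> borel_measurable borel"
    using is_weak_gradient_weak_grad[OF assms]
    by (intro locally_integrable_UNIV_measurable) (simp add: is_weak_gradient_def)
  show ?thesis
    unfolding tangential_deriv_def[abs_def] by measurable
qed

text \<open>Membership can be checked with any convenient weak derivative \<open>H\<close> in place
  of the arbitrarily chosen one.\<close>

lemma W12_bdryI:
  assumes h: "h \<in> weighted_L2 (bdry_length l) (weight (\<alpha> - 1))"
    and H: "is_weak_gradient UNIV (h \<circ> bdry_point l) H"
    and L2: "(\<lambda>y. H (arc_coord l y)) \<in> weighted_L2 (bdry_length l) (weight \<alpha>)"
  shows "h \<in> W12_bdry \<alpha> l"
proof -
  have wd: "weakly_differentiable UNIV (h \<circ> bdry_point l)"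
    using H by (auto simp: weakly_differentiable_def)
  note [measurable] = measurable_tangential_deriv[OF wd]
  have [measurable]: "H \<in> borel_measurable borel"
    using H by (intro locally_integrable_UNIV_measurable) (simp add: is_weak_gradient_def)
  have "integrable (bdry_length l) (\<lambda>y. weight \<alpha> y * (tangential_deriv l h y)\<^sup>2)
      \<longleftrightarrow> integrable (bdry_length l) (\<lambda>y. weight \<alpha> y * (H (arc_coord l y))\<^sup>2)"
    using tangential_deriv_AE[OF H]
    by (intro integrable_cong_AE) (auto elim: eventually_mono)
  then have "tangential_deriv l h \<in> weighted_L2 (bdry_length l) (weight \<alpha>)"
    using L2 by (simp add: weighted_L2_def)
  with h wd show ?thesis
    by (simp add: W12_bdry_def)
qed

text \<open>The combination of the chosen derivatives is a weak derivative of the combination. It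
  may differ from the chosen one, but \<open>W12_bdryI\<close> accepts it.\<close>

lemma W12_bdry_lincomb:
  assumes f: "f \<in> W12_bdry \<alpha> l" and g: "g \<in> W12_bdry \<alpha> l"
  shows "(\<lambda>x. a * f x + b * g x) \<in> W12_bdry \<alpha> l"
proof (rule W12_bdryI)
  let ?F = "weak_grad UNIV (f \<circ> bdry_point l)" and ?G = "weak_grad UNIV (g \<circ> bdry_point l)"
  show "(\<lambda>x. a * f x + b * g x) \<in> weighted_L2 (bdry_length l) (weight (\<alpha> - 1))"
    using f g by (intro weighted_L2_lincomb) (auto simp: W12_bdry_def weight_pos less_imp_le)
  have "is_weak_gradient UNIV (f \<circ> bdry_point l) ?F" "is_weak_gradient UNIV (g \<circ> bdry_point l) ?G"
    using f g by (auto simp: W12_bdry_def intro: is_weak_gradient_weak_grad)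
  from is_weak_gradient_lincomb[OF this, of a b]
  show "is_weak_gradient UNIV ((\<lambda>x. a * f x + b * g x) \<circ> bdry_point l) (\<lambda>t. a * ?F t + b * ?G t)"
    by (simp add: comp_def)
  have "(\<lambda>y. a * tangential_deriv l f y + b * tangential_deriv l g y)
      \<in> weighted_L2 (bdry_length l) (weight \<alpha>)"
    using f g by (intro weighted_L2_lincomb) (auto simp: W12_bdry_def weight_pos less_imp_le)
  then show "(\<lambda>y. a * ?F (arc_coord l y) + b * ?G (arc_coord l y))
      \<in> weighted_L2 (bdry_length l) (weight \<alpha>)"
    by (simp add: tangential_deriv_def)
qed

lemma is_weak_gradient_zero: "is_weak_gradient U (\<lambda>x. 0) (\<lambda>x. 0)"
  by (simp add: is_weak_gradient_def locally_integrable_def set_integrable_def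
      set_lebesgue_integral_def)

text \<open>Together with the next lemma this puts an element into the unit ball over which the dual
  norm takes its supremum.\<close>

lemma zero_in_W12_bdry: "(\<lambda>y. 0) \<in> W12_bdry \<alpha> l"
  by (rule W12_bdryI[where H = "\<lambda>t. 0"])
    (simp_all add: weighted_L2_def comp_def is_weak_gradient_zero)

text \<open>The chosen weak derivative of the zero function is known to vanish only almost
  everywhere, so the integral is evaluated through an almost-everywhere identity.\<close>

lemma W12_bdry_norm_zero: "W12_bdry_norm \<alpha> l (\<lambda>y. 0) = 0"
proof -
  have zero: "is_weak_gradient UNIV ((\<lambda>y. 0) \<circ> bdry_point l) (\<lambda>t. 0)"
    by (simp add: comp_def is_weak_gradient_zero)
  have "AE y in bdry_length l.
      weight (\<alpha> - 1) y * 0\<^sup>2 + weight \<alpha> y * (tangential_deriv l (\<lambda>y. 0) y)\<^sup>2 = 0"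
    using tangential_deriv_AE[OF zero] by eventually_elim simp
  then show ?thesis
    unfolding W12_bdry_norm_def by (subst integral_eq_zero_AE) auto
qed

section \<open>Symmetry of the operator and its transpose\<close>

text \<open>Green's formula for \<open>v\<close> tested with \<open>v'\<close>, whose trace is
  \<open>g'\<close>, and the same formula with the roles exchanged turn both sides into one
  symmetric Dirichlet integral.\<close>

lemma is_normal_deriv_commute:
  assumes "solves_dirichlet l g v" "is_normal_deriv l v f"
    and "solves_dirichlet l g' v'" "is_normal_deriv l v' f'"
  shows "bdry_pairing l f g' = bdry_pairing l f' g"
  using assms unfolding solves_dirichlet_def is_normal_deriv_def bdry_pairing_def
  by (metis (no_types, lifting) Bochner_Integration.integral_cong inner_commute)

text \<open>The witness \<open>f\<close> keeps the set under the supremum nonempty, as the least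
  upper bound property of the reals demands.\<close>

lemma dual_norm_le:
  assumes "f \<in> V" "N f \<le> 1" "\<And>f. f \<in> V \<Longrightarrow> N f \<le> 1 \<Longrightarrow> \<bar>F f\<bar> \<le> C"
  shows "dual_norm V N F \<le> C"
  unfolding dual_norm_def using assms by (intro cSup_least) auto

theorem proposition5:
  fixes l :: real
    and T :: "(real \<times> real \<Rightarrow> real) \<Rightarrow> real \<times> real \<Rightarrow> real"
  assumes "l \<ge> 0"
    and "continuous_linear_map (W12_bdry (1/2) l) (W12_bdry_norm (1/2) l)
           (W02_bdry (1/2) l) (W02_bdry_norm (1/2) l) T"
    and "\<And>g. g \<in> W12_bdry (1/2) l \<Longrightarrow>
           \<exists>v. solves_dirichlet l g v \<and> is_normal_deriv l v (T g)"
  shows "\<exists>S. continuous_linear_map (W02_bdry (-1/2) l) (W02_bdry_norm (-1/2) l)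
               (Wm12_bdry (-1/2) l) (Wm12_bdry_norm (-1/2) l) S \<and>
             (\<forall>g\<in>W12_bdry (1/2) l. \<forall>h\<in>W12_bdry (1/2) l. S g h = bdry_pairing l (T g) h)"
proof -
  let ?V = "W12_bdry (1/2) l" and ?N = "W12_bdry_norm (1/2) l"
  let ?M = "bdry_length l" and ?w = "weight (1/2)" and ?w' = "weight (- 1/2)"
  define S where "S g h = bdry_pairing l (T h) g" for g h
  have TV: "T h \<in> weighted_L2 ?M ?w" if "h \<in> ?V" for h
    using assms(2) that by (simp add: continuous_linear_map_def W02_bdry_def)
  obtain C0 where "\<And>h. h \<in> ?V \<Longrightarrow> weighted_L2_norm ?M ?w (T h) \<le> C0 * ?N h"
    using assms(2) unfolding continuous_linear_map_def W02_bdry_norm_def by blast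
  \<comment> \<open>\<open>C0\<close> may be negative; a nonnegative constant is wanted below, where
    \<open>?N h\<close> is replaced by its bound 1.\<close>
  moreover define C where "C = max 0 C0"
  moreover have N0: "0 \<le> ?N h" for h
    unfolding W12_bdry_norm_def
    by (auto intro!: integral_nonneg_AE add_nonneg_nonneg mult_nonneg_nonneg
        simp: weight_pos less_imp_le)
  ultimately have C: "weighted_L2_norm ?M ?w (T h) \<le> C * ?N h" "0 \<le> C" if "h \<in> ?V" for h
    using that by (smt (verit) mult_right_mono)+
  have L20: "0 \<le> weighted_L2_norm ?M ?w' g" for g
    unfolding weighted_L2_norm_def
    by (auto intro!: integral_nonneg_AE simp: weight_pos less_imp_le)
  have ww: "0 \<le> ?w y" "0 \<le> ?w' y" "?w y * ?w' y = 1" for y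
  proof -
    have "1 + (norm y)\<^sup>2 \<noteq> 0"
      by (smt (verit) zero_le_power2)
    then show "?w y * ?w' y = 1"
      by (simp add: weight_def powr_add[symmetric])
  qed (simp_all add: weight_pos less_imp_le)
  note pairing = integrable_mult_dual_weights[OF ww]
  have sym: "S g h = bdry_pairing l (T g) h" if "g \<in> ?V" "h \<in> ?V" for g h
    unfolding S_def using assms(3) that by (metis is_normal_deriv_commute)
  have bound: "\<bar>S g h\<bar> \<le> C * weighted_L2_norm ?M ?w' g * ?N h"
    if g: "g \<in> weighted_L2 ?M ?w'" and h: "h \<in> ?V" for g h
  proof -
    have "\<bar>S g h\<bar> \<le> weighted_L2_norm ?M ?w (T h) * weighted_L2_norm ?M ?w' g"
      unfolding S_def bdry_pairing_def by (rule pairing(2)[OF TV[OF h] g])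
    also have "\<dots> \<le> C * ?N h * weighted_L2_norm ?M ?w' g"
      by (intro mult_right_mono C h L20)
    finally show ?thesis
      by (simp add: mult_ac)
  qed
  have lin2: "S g (\<lambda>x. a * h x + b * k x) = a * S g h + b * S g k"
    if g: "g \<in> weighted_L2 ?M ?w'" and h: "h \<in> ?V" and k: "k \<in> ?V" for g h k a b
  proof -
    let ?hk = "\<lambda>x. a * h x + b * k x"
    have hk: "?hk \<in> ?V"
      by (rule W12_bdry_lincomb[OF h k])
    note T = TV[OF h] TV[OF k] TV[OF hk]
    have "(\<lambda>z. a * T h z + b * T k z) \<in> weighted_L2 ?M ?w"
      by (rule weighted_L2_lincomb) (use T ww in auto)
    \<comment> \<open>\<open>T\<close> is linear only modulo null functions. The defect lies in the
      weighted space and has norm 0, hence it vanishes almost everywhere and does not affect the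
      pairing with \<open>g\<close>.\<close>
    from weighted_L2_lincomb[OF ww(1) _ T(3) this, of 1 "- 1"]
    have "(\<lambda>z. T ?hk z - (a * T h z + b * T k z)) \<in> weighted_L2 ?M ?w"
      by (simp add: algebra_simps)
    moreover have "weighted_L2_norm ?M ?w (\<lambda>z. T ?hk z - (a * T h z + b * T k z)) = 0"
      using assms(2) h k unfolding continuous_linear_map_def W02_bdry_norm_def by blast
    ultimately have "AE z in ?M. T ?hk z - (a * T h z + b * T k z) = 0"
      by (rule AE_zero_if_weighted_L2_norm_zero[OF weight_pos])
    moreover have [measurable]: "T h \<in> borel_measurable ?M" "T k \<in> borel_measurable ?M"
      "T ?hk \<in> borel_measurable ?M" "g \<in> borel_measurable ?M"
      using T g by (auto simp: weighted_L2_def)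
    ultimately have "S g ?hk = (LINT y|?M. (a * T h y + b * T k y) * g y)"
      unfolding S_def bdry_pairing_def
      by (intro integral_cong_AE) (measurable, auto elim: eventually_mono)
    also have "\<dots> = (LINT y|?M. a * (T h y * g y) + b * (T k y * g y))"
      by (simp add: algebra_simps)
    also have "\<dots> = a * S g h + b * S g k"
      using pairing(1)[OF T(1) g] pairing(1)[OF T(2) g] by (simp add: S_def bdry_pairing_def)
    finally show ?thesis .
  qed
  have lin1: "S (\<lambda>x. a * g x + b * k x) h = a * S g h + b * S k h"
    if g: "g \<in> weighted_L2 ?M ?w'" and k: "k \<in> weighted_L2 ?M ?w'" and h: "h \<in> ?V" for g h k a b
  proof -
    have "S (\<lambda>x. a * g x + b * k x) h = (LINT y|?M. a * (T h y * g y) + b * (T h y * k y))"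
      by (simp add: S_def bdry_pairing_def algebra_simps)
    also have "\<dots> = a * S g h + b * S k h"
      using pairing(1)[OF TV[OF h] g] pairing(1)[OF TV[OF h] k]
      by (simp add: S_def bdry_pairing_def)
    finally show ?thesis .
  qed
  note zero = zero_in_W12_bdry[of "1/2" l] W12_bdry_norm_zero[of "1/2" l]
  have "continuous_linear_map (weighted_L2 ?M ?w') (weighted_L2_norm ?M ?w')
      (dual_space ?V ?N) (dual_norm ?V ?N) S"
    unfolding continuous_linear_map_def
  proof (intro conjI ballI allI exI)
    show "S g \<in> dual_space ?V ?N" if "g \<in> weighted_L2 ?M ?w'" for g
      using bound[OF that] lin2[OF that] unfolding dual_space_def by blast
    show "dual_norm ?V ?N (\<lambda>h. S (\<lambda>x. a * g x + b * k x) h - (a * S g h + b * S k h)) = 0"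
      if "g \<in> weighted_L2 ?M ?w'" "k \<in> weighted_L2 ?M ?w'" for g k a b
    proof -
      \<comment> \<open>All these values are 0 by linearity in the first argument, and the zero
        function makes the set nonempty, so its supremum is 0.\<close>
      have "{\<bar>S (\<lambda>x. a * g x + b * k x) h - (a * S g h + b * S k h)\<bar> | h. h \<in> ?V \<and> ?N h \<le> 1} = {0}"
        using zero lin1[OF that, of _ a b] by (auto intro!: exI[of _ "\<lambda>y. 0"])
      then show ?thesis
        by (simp add: dual_norm_def)
    qed
    show "dual_norm ?V ?N (S g) \<le> C * weighted_L2_norm ?M ?w' g"
      if g: "g \<in> weighted_L2 ?M ?w'" for g
    proof (rule dual_norm_le)
      fix h
      assume h: "h \<in> ?V" "?N h \<le> 1"
      have "C * weighted_L2_norm ?M ?w' g * ?N h \<le> C * weighted_L2_norm ?M ?w' g * 1"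
        using C(2)[OF h(1)] L20 h by (intro mult_left_mono) auto
      then show "\<bar>S g h\<bar> \<le> C * weighted_L2_norm ?M ?w' g"
        using bound[OF g h(1)] by simp
    qed (use zero in auto)
  qed
  \<comment> \<open>The exponent of the predual is \<open>- (-1/2)\<close>, that is 1/2, so the
    target is the dual of \<open>?V\<close>.\<close>
  then have "continuous_linear_map (W02_bdry (-1/2) l) (W02_bdry_norm (-1/2) l)
      (Wm12_bdry (-1/2) l) (Wm12_bdry_norm (-1/2) l) S"
    by (simp add: W02_bdry_def W02_bdry_norm_def Wm12_bdry_def Wm12_bdry_norm_def)
  then show ?thesis
    using sym by blast
qed

end
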